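(* Let $\mathbf A=\{a_{ij}\}_{i,j=1}^n$ and $\mathbf B=\{b_{ij}\}_{i,j=1}^n$ be real $n\times n$ matrices, and let $\mathbf C$ be the real $2n\times 2n$ matrix $$\mathbf C=\begin{pmatrix}\mathbf A & \mathbf B\\ \mathbf I & \mathbf O\end{pmatrix},$$ where $\mathbf I$ is the $n\times n$ identity matrix and $\mathbf O$ the $n\times n$ zero matrix. Suppose $a_{ii}<0$ and $b_{ii}<0$ for all $i$. If, in addition, $b_{ij}=0$ for all $i\neq j$ and $\mathbf A$ is negative diagonally dominant (NDD), then $\mathbf C$ is multiplicative $D$-stable.
   Context: A real $n\times n$ matrix $\mathbf A=\{a_{ij}\}$ is negative diagonally dominant (NDD) if $a_{ii}<0$ for all $i$ and there exist positive scalars $m_1,\dots,m_n$ such that $m_i|a_{ii}|>\sum_{j\ne i}m_j|a_{ij}|$ for $i=1,\dots,n$. A real square matrix is stable if all its eigenvalues have negative real parts. A real $N\times N$ matrix $\mathbf C$ is multiplicative $D$-stable if $\mathbf D\mathbf C$ is stable for every $N\times N$ positive diagonal matrix $\mathbf D$ (diagonal with all diagonal entries positive). *)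

theory Defs
  imports Complex_Main "Jordan_Normal_Form.Char_Poly"
begin

definition ndd :: "real mat \<Rightarrow> bool" where
  "ndd A \<longleftrightarrow> square_mat A \<and>
     (\<forall>i<dim_row A. A $$ (i,i) < 0) \<and>
     (\<exists>m :: nat \<Rightarrow> real. (\<forall>i<dim_row A. 0 < m i) \<and>
        (\<forall>i<dim_row A.
           m i * \<bar>A $$ (i,i)\<bar> > (\<Sum>j\<in>{0..<dim_row A} - {i}. m j * \<bar>A $$ (i,j)\<bar>)))"

text \<open>The eigenvalues of a real matrix range over the complex numbers, hence the embedding.\<close>

definition stable_mat :: "real mat \<Rightarrow> bool" where
  "stable_mat M \<longleftrightarrow> square_mat M \<and>
     (\<forall>k :: complex. eigenvalue (map_mat complex_of_real M) k \<longrightarrow> Re k < 0)"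

definition pos_diagonal_mat :: "nat \<Rightarrow> real mat \<Rightarrow> bool" where
  "pos_diagonal_mat N D \<longleftrightarrow>
     D \<in> carrier_mat N N \<and> diagonal_mat D \<and> (\<forall>i<N. 0 < D $$ (i,i))"

definition mult_D_stable :: "real mat \<Rightarrow> bool" where
  "mult_D_stable C \<longleftrightarrow> square_mat C \<and>
     (\<forall>D. pos_diagonal_mat (dim_row C) D \<longrightarrow> stable_mat (D * C))"

end

theory Submission
  imports Defs
begin

text \<open>
  Let \<open>(x, y)\<close> be an eigenvector of \<open>D * C\<close> for \<open>k\<close> with \<open>Re k \<ge> 0\<close>, and write \<open>d\<close>, \<open>e\<close> for the two
  halves of the diagonal of \<open>D\<close>. The lower half gives \<open>k y = e x\<close>, so \<open>k \<noteq> 0\<close> and the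
  upper half becomes \<open>(k - d a\<^sub>i\<^sub>i - d b e / k) x\<^sub>i = d (\<Sum>j\<noteq>i. a\<^sub>i\<^sub>j x\<^sub>j)\<close>. As \<open>Re (1 / k) \<ge> 0\<close>, the
  factor on the left has real part at least \<open>d \<bar>a\<^sub>i\<^sub>i\<bar>\<close>. Hence
  \<open>\<bar>a\<^sub>i\<^sub>i\<bar> \<bar>x\<^sub>i\<bar> \<le> (\<Sum>j\<noteq>i. \<bar>a\<^sub>i\<^sub>j\<bar> \<bar>x\<^sub>j\<bar>)\<close> for all \<open>i\<close>, which contradicts diagonal dominance at an
  index maximising \<open>\<bar>x\<^sub>i\<bar> / m\<^sub>i\<close>.
\<close>

lemma index_diagonal_mult_mat:
  fixes D M :: "'a :: comm_semiring_1 mat"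
  assumes D: "D \<in> carrier_mat N N" "diagonal_mat D" and M: "M \<in> carrier_mat N K"
    and "i < N" "j < K"
  shows "(D * M) $$ (i,j) = D $$ (i,i) * M $$ (i,j)"
proof -
  have "(D * M) $$ (i,j) = (\<Sum>l\<in>{0..<N}. D $$ (i,l) * M $$ (l,j))"
    using assms by (simp add: scalar_prod_def)
  also have "\<dots> = (\<Sum>l\<in>{0..<N}. if l = i then D $$ (i,i) * M $$ (i,j) else 0)"
    using D \<open>i < N\<close> by (intro sum.cong) (auto simp: diagonal_mat_def)
  also have "\<dots> = D $$ (i,i) * M $$ (i,j)"
    using \<open>i < N\<close> by simp
  finally show ?thesis .
qed

text \<open>Rescaling \<open>norm (x j) = m j * r j\<close> turns weighted dominance into the
  unweighted kind: in a row where \<open>r\<close> is largest, every \<open>r j\<close> may be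
  replaced by the maximum, and the row then contradicts its own strict inequality.\<close>

lemma dominant_imp_zero:
  fixes x :: "nat \<Rightarrow> 'b :: real_normed_vector" and a :: "nat \<Rightarrow> nat \<Rightarrow> real"
  assumes m: "\<And>i. i < n \<Longrightarrow> 0 < m i"
    and dom: "\<And>i. i < n \<Longrightarrow> (\<Sum>j\<in>{0..<n} - {i}. m j * \<bar>a i j\<bar>) < m i * \<bar>a i i\<bar>"
    and le: "\<And>i. i < n \<Longrightarrow> \<bar>a i i\<bar> * norm (x i) \<le> (\<Sum>j\<in>{0..<n} - {i}. \<bar>a i j\<bar> * norm (x j))"
    and "i < n"
  shows "x i = 0"
proof (rule ccontr)
  assume nz: "x i \<noteq> 0"
  define r where "r j = norm (x j) / m j" for j
  have fin: "finite (r ` {0..<n})" "r ` {0..<n} \<noteq> {}"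
    using \<open>i < n\<close> by auto
  from Max_in[OF fin] obtain p where p: "p < n" "r p = Max (r ` {0..<n})"
    by auto
  have max: "r j \<le> r p" if "j < n" for j
    using that p(2) fin(1) by simp
  \<comment> \<open>A nonzero entry makes the maximum positive, so multiplying the dominance
    inequality by \<open>r p\<close> keeps it strict.\<close>
  have rp: "0 < r p"
    using max[OF \<open>i < n\<close>] nz m[OF \<open>i < n\<close>] by (smt (verit) r_def zero_less_divide_iff zero_less_norm_iff)
  have xr: "norm (x j) = m j * r j" if "j < n" for j
    using m[OF that] by (simp add: r_def)
  have "\<bar>a p p\<bar> * norm (x p) \<le> (\<Sum>j\<in>{0..<n} - {p}. \<bar>a p j\<bar> * norm (x j))"
    by (rule le[OF p(1)])
  also have "\<dots> \<le> (\<Sum>j\<in>{0..<n} - {p}. (m j * \<bar>a p j\<bar>) * r p)"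
  proof (rule sum_mono)
    fix j assume "j \<in> {0..<n} - {p}"
    then have j: "j < n" by simp
    have "\<bar>a p j\<bar> * norm (x j) = (m j * \<bar>a p j\<bar>) * r j"
      using xr[OF j] by simp
    also have "\<dots> \<le> (m j * \<bar>a p j\<bar>) * r p"
      using max[OF j] m[OF j] by (intro mult_left_mono) auto
    finally show "\<bar>a p j\<bar> * norm (x j) \<le> (m j * \<bar>a p j\<bar>) * r p" .
  qed
  also have "\<dots> = (\<Sum>j\<in>{0..<n} - {p}. m j * \<bar>a p j\<bar>) * r p"
    by (simp add: sum_distrib_right)
  also have "\<dots> < (m p * \<bar>a p p\<bar>) * r p"
    using dom[OF p(1)] rp by (rule mult_strict_right_mono)
  also have "\<dots> = \<bar>a p p\<bar> * norm (x p)"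
    using xr[OF p(1)] by simp
  finally show False by simp
qed

text \<open>The inverse is the conjugate divided by the squared modulus; for \<open>k = 0\<close>
  the convention \<open>inverse 0 = 0\<close> applies.\<close>

lemma Re_inverse_nonneg: "0 \<le> Re k \<Longrightarrow> 0 \<le> Re (inverse k)"
  by (simp add: complex_inverse divide_nonneg_nonneg)

text \<open>Here \<open>s\<close> stands for the off-diagonal part of a row of \<open>A\<close>
  applied to \<open>x\<close>. Eliminating \<open>y\<close> leaves \<open>c * x = d * s\<close>, and
  the signs of \<open>a\<close> and \<open>b\<close> make all three contributions to
  \<open>Re c\<close> nonnegative, so \<open>norm c\<close> is at least the middle one,
  \<open>d * \<bar>a\<bar>\<close>; then \<open>d\<close> cancels.\<close>

lemma row_estimate:
  fixes k x s :: complex and d e a b :: real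
  assumes k: "0 \<le> Re k" "k \<noteq> 0"
    and d: "0 < d" and e: "0 < e" and a: "a < 0" and b: "b < 0"
    and x: "k * x = of_real d * (of_real a * x + s + of_real b * y)"
    and y: "k * y = of_real e * x"
  shows "\<bar>a\<bar> * norm x \<le> norm s"
proof -
  define c where "c = k - of_real (d * a) - of_real (d * b * e) * inverse k"
  have y': "y = of_real e * x * inverse k"
    using y k(2) by (simp add: field_simps)
  have eq: "c * x = of_real d * s"
    using x unfolding c_def y' by (simp add: algebra_simps)
  have "d * b * e * Re (inverse k) \<le> 0"
    by (intro mult_nonpos_nonneg mult_nonneg_nonpos Re_inverse_nonneg k(1) less_imp_le d e b)
  \<comment> \<open>\<open>Re (inverse k)\<close> must stay folded to match the preceding
    inequality.\<close>
  moreover have "Re c = Re k - d * a - d * b * e * Re (inverse k)"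
    unfolding c_def by (simp del: inverse_complex.sel)
  ultimately have "d * \<bar>a\<bar> \<le> Re c"
    using k(1) a by simp
  also have "\<dots> \<le> norm c"
    by (rule complex_Re_le_cmod)
  finally have "d * \<bar>a\<bar> * norm x \<le> norm (c * x)"
    by (simp add: norm_mult mult_right_mono)
  also have "\<dots> = d * norm s"
    using d by (simp add: eq norm_mult)
  finally show ?thesis
    using d by simp
qed

theorem theorem1:
  fixes n :: nat and A B C :: "real mat"
  assumes "A \<in> carrier_mat n n"
    and "B \<in> carrier_mat n n"
    and "C = four_block_mat A B (1\<^sub>m n) (0\<^sub>m n n)"
    and "\<forall>i<n. A $$ (i,i) < 0"
    and "\<forall>i<n. B $$ (i,i) < 0"
    and "\<forall>i<n. \<forall>j<n. i \<noteq> j \<longrightarrow> B $$ (i,j) = 0"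
    and "ndd A"
  shows "mult_D_stable C"
proof -
  note A = assms(1) and B = assms(2)
  have C: "C \<in> carrier_mat (n + n) (n + n)"
    unfolding assms(3) using A by simp
  obtain m where m: "\<And>i. i < n \<Longrightarrow> 0 < m i"
    and dom: "\<And>i. i < n \<Longrightarrow> (\<Sum>j\<in>{0..<n} - {i}. m j * \<bar>A $$ (i,j)\<bar>) < m i * \<bar>A $$ (i,i)\<bar>"
    using assms(7) A unfolding ndd_def by auto
  have "Re k < 0"
    if D: "D \<in> carrier_mat (n + n) (n + n)" "diagonal_mat D" "\<forall>i<n + n. 0 < D $$ (i,i)"
      and k: "eigenvalue (map_mat complex_of_real (D * C)) k" for D k
  proof (rule ccontr)
    assume "\<not> Re k < 0"
    then have Re: "0 \<le> Re k" by simp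
    define d e where "d i = D $$ (i,i)" and "e i = D $$ (n + i,n + i)" for i
    have d: "0 < d i" and e: "0 < e i" if "i < n" for i
      using D(3) that by (auto simp: d_def e_def)
    let ?M = "map_mat complex_of_real (D * C)"
    have M: "?M \<in> carrier_mat (n + n) (n + n)"
      using C D by auto
    obtain v where v: "v \<in> carrier_vec (n + n)" "v \<noteq> 0\<^sub>v (n + n)" "?M *\<^sub>v v = k \<cdot>\<^sub>v v"
      using k M unfolding eigenvalue_def eigenvector_def by auto
    define x y where "x i = v $ i" and "y i = v $ (n + i)" for i
    \<comment> \<open>Left multiplication by \<open>D\<close> only scales row \<open>i\<close> of
      \<open>C\<close>; the sum over its columns is split at \<open>n\<close> into the
      \<open>x\<close> and \<open>y\<close> halves.\<close>
    have row: "k * v $ i =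
        of_real (D $$ (i,i)) * ((\<Sum>j\<in>{0..<n}. of_real (C $$ (i,j)) * x j)
          + (\<Sum>j\<in>{0..<n}. of_real (C $$ (i,n + j)) * y j))" if i: "i < n + n" for i
    proof -
      have "k * v $ i = (?M *\<^sub>v v) $ i"
        using i v by simp
      also have "\<dots> = (\<Sum>j\<in>{0..<n + n}. ?M $$ (i,j) * v $ j)"
        using i v(1) C D(1) by (simp add: scalar_prod_def)
      also have "\<dots> = (\<Sum>j\<in>{0..<n + n}. of_real (D $$ (i,i)) * (of_real (C $$ (i,j)) * v $ j))"
        using i C D index_diagonal_mult_mat[OF D(1,2) C i] by (intro sum.cong) auto
      also have "\<dots> = of_real (D $$ (i,i)) * (\<Sum>j\<in>{0..<n + n}. of_real (C $$ (i,j)) * v $ j)"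
        by (simp add: sum_distrib_left)
      also have "(\<Sum>j\<in>{0..<n + n}. of_real (C $$ (i,j)) * v $ j) =
          (\<Sum>j\<in>{0..<n}. of_real (C $$ (i,j)) * x j) + (\<Sum>j\<in>{0..<n}. of_real (C $$ (i,n + j)) * y j)"
        using sum.atLeastLessThan_concat[of 0 n "n + n" "\<lambda>j. of_real (C $$ (i,j)) * v $ j"]
          sum.shift_bounds_nat_ivl[of "\<lambda>j. of_real (C $$ (i,j)) * v $ j" 0 n n]
        by (simp add: x_def y_def add.commute)
      finally show ?thesis .
    qed
    have lower: "k * y i = of_real (e i) * x i" if i: "i < n" for i
    proof -
      have "(\<Sum>j\<in>{0..<n}. complex_of_real (C $$ (n + i,j)) * x j) = (\<Sum>j\<in>{0..<n}. if j = i then x i else 0)"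
        using A B i unfolding assms(3) by (intro sum.cong) auto
      moreover have "(\<Sum>j\<in>{0..<n}. complex_of_real (C $$ (n + i,n + j)) * y j) = 0"
        using A B i unfolding assms(3) by (intro sum.neutral) auto
      ultimately show ?thesis
        using row[of "n + i"] i by (simp add: e_def y_def)
    qed
    have upper: "k * x i = of_real (d i) * (of_real (A $$ (i,i)) * x i
        + (\<Sum>j\<in>{0..<n} - {i}. of_real (A $$ (i,j)) * x j) + of_real (B $$ (i,i)) * y i)"
      if i: "i < n" for i
    proof -
      have "(\<Sum>j\<in>{0..<n}. complex_of_real (C $$ (i,j)) * x j) = (\<Sum>j\<in>{0..<n}. of_real (A $$ (i,j)) * x j)"
        using A B i unfolding assms(3) by (intro sum.cong) auto
      also have "\<dots> = of_real (A $$ (i,i)) * x i + (\<Sum>j\<in>{0..<n} - {i}. of_real (A $$ (i,j)) * x j)"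
        using i by (intro sum.remove) auto
      \<comment> \<open>Since \<open>B\<close> is diagonal, row \<open>i\<close> couples to
        \<open>y\<close> through \<open>y i\<close> alone, which \<open>lower\<close> can then
        eliminate.\<close>
      moreover have "(\<Sum>j\<in>{0..<n}. complex_of_real (C $$ (i,n + j)) * y j) =
          (\<Sum>j\<in>{0..<n}. if j = i then of_real (B $$ (i,i)) * y i else 0)"
        using A B i assms(6) unfolding assms(3) by (intro sum.cong) auto
      ultimately show ?thesis
        using row[of i] i by (simp add: d_def x_def)
    qed
    have x0: "x i = 0" if i: "i < n" for i
    \<comment> \<open>\<open>row_estimate\<close> divides by \<open>k\<close>. For
      \<open>k = 0\<close> the lower equation already reads \<open>e i * x i = 0\<close>.\<close>
    proof (cases "k = 0")
      case True
      then show ?thesis using lower[OF i] e[OF i] by simp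
    next
      case False
      show ?thesis
      proof (rule dominant_imp_zero[where a = "\<lambda>i j. A $$ (i,j)", OF m dom _ i])
        fix i assume i: "i < n"
        have "\<bar>A $$ (i,i)\<bar> * norm (x i) \<le> norm (\<Sum>j\<in>{0..<n} - {i}. of_real (A $$ (i,j)) * x j)"
          using row_estimate[OF Re False d[OF i] e[OF i] _ _ upper[OF i] lower[OF i]]
            assms(4,5) i by simp
        also have "\<dots> \<le> (\<Sum>j\<in>{0..<n} - {i}. \<bar>A $$ (i,j)\<bar> * norm (x j))"
          by (rule order_trans[OF norm_sum]) (simp add: norm_mult)
        finally show "\<bar>A $$ (i,i)\<bar> * norm (x i) \<le> (\<Sum>j\<in>{0..<n} - {i}. \<bar>A $$ (i,j)\<bar> * norm (x j))" .
      qed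
    qed
    \<comment> \<open>The upper equation is used because it also covers \<open>k = 0\<close>, where
      the lower one says nothing about \<open>y\<close>: with \<open>x\<close> zero it becomes
      \<open>d i * B $$ (i,i) * y i = 0\<close>.\<close>
    have y0: "y i = 0" if i: "i < n" for i
    proof -
      have "d i * B $$ (i,i) \<noteq> 0"
        using d[OF i] assms(5) i by auto
      then show ?thesis
        using upper[OF i] x0 i by simp
    qed
    have "v $ i = 0" if "i < n + n" for i
      using x0[of i] y0[of "i - n"] that by (cases "i < n") (auto simp: x_def y_def)
    then have "v = 0\<^sub>v (n + n)"
      using v(1) by (intro eq_vecI) auto
    with v(2) show False by simp
  qed
  then show ?thesis
    using C unfolding mult_D_stable_def stable_mat_def pos_diagonal_mat_def by auto
qed

end
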